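(* Let $A$ be a set and let $\to_{\mathsf e\alpha},\to_{\mathsf i\alpha},\to_{\mathsf e\gamma},\to_{\mathsf i\gamma}$ be binary relations on $A$. Put $\to_\alpha := \to_{\mathsf e\alpha}\cup\to_{\mathsf i\alpha}$, $\to_\gamma := \to_{\mathsf e\gamma}\cup\to_{\mathsf i\gamma}$, $\to_{\mathsf e} := \to_{\mathsf e\alpha}\cup\to_{\mathsf e\gamma}$ and $\to_{\mathsf i} := \to_{\mathsf i\alpha}\cup\to_{\mathsf i\gamma}$. Assume that $\to_\alpha$ is $\mathsf e$-factorizing, i.e. $(\to_{\mathsf e\alpha}\cup\to_{\mathsf i\alpha})^*\subseteq \to_{\mathsf e\alpha}^*\cdot\to_{\mathsf i\alpha}^*$, and that $\to_\gamma$ is $\mathsf e$-factorizing, i.e. $(\to_{\mathsf e\gamma}\cup\to_{\mathsf i\gamma})^*\subseteq \to_{\mathsf e\gamma}^*\cdot\to_{\mathsf i\gamma}^*$. Assume moreover the two linear swap conditions $$\to_{\mathsf i\alpha}\cdot\to_{\mathsf e\gamma}\ \subseteq\ \to_{\mathsf e\gamma}\cdot\to_\alpha^* \qquad\text{and}\qquad \to_{\mathsf i\gamma}\cdot\to_{\mathsf e\alpha}\ \subseteq\ \to_{\mathsf e\alpha}\cdot\to_\gamma^*.$$ Then $\to_\alpha\cup\to_\gamma$ satisfies $\mathsf e$-factorization: $(\to_{\mathsf e}\cup\to_{\mathsf i})^*\subseteq \to_{\mathsf e}^*\cdot\to_{\mathsf i}^*$.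
   Context: For a binary relation $\to$ on $A$, $\to^*$ denotes its reflexive-transitive closure. For relations $R,S$ on $A$, $R\cdot S$ is their composition: $t\,(R\cdot S)\,s$ iff there is $u\in A$ with $t\,R\,u$ and $u\,S\,s$. *)

theory Defs
  imports Main
begin

definition e_factorizing :: "'a rel \<Rightarrow> 'a rel \<Rightarrow> bool" where
  "e_factorizing e i \<longleftrightarrow> (e \<union> i)\<^sup>* \<subseteq> e\<^sup>* O i\<^sup>*"

end

theory Submission
  imports Defs
begin

text \<open>
  Sequences of internal steps of a single kind can be postponed past every external step: an
  \<open>\<alpha>\<close>-internal sequence followed by an \<open>e\<alpha>\<close> step is refactorized inside \<open>\<alpha>\<close>, and one followed
  by an \<open>e\<gamma>\<close> step is linearly swapped, after which the resulting \<open>\<alpha>\<close>-sequence is refactorized.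
  Either way only \<open>\<alpha>\<close>-internal steps remain on the right, so the argument can be iterated
  along a whole external sequence.
\<close>

text \<open>Pulling the \<open>s\<close> step leftwards over one \<open>r\<close> step never
  duplicates it, and the \<open>t\<close> steps created stay to its right, where they merely
  accumulate.\<close>

lemma star_swap:
  assumes "r O s \<subseteq> s O t\<^sup>*" and "r \<subseteq> t"
  shows "r\<^sup>* O s \<subseteq> s O t\<^sup>*"
proof -
  have "(y, z) \<in> s \<Longrightarrow> (x, z) \<in> s O t\<^sup>*" if "(x, y) \<in> r\<^sup>*" for x y z
    using that
  proof (induction rule: converse_rtrancl_induct)
    case base
    then show ?case by blast
  next
    case (step x x')
    then obtain u where u: "(x', u) \<in> s" "(u, z) \<in> t\<^sup>*" by blast
    with step.hyps(1) assms(1) obtain v where "(x, v) \<in> s" "(v, u) \<in> t\<^sup>*" by blast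
    with u(2) show ?case by (meson relcompI rtrancl_trans)
  qed
  then show ?thesis by blast
qed

text \<open>One \<open>s\<close> step may turn into many, but only \<open>r\<close> steps are left
  after them, so induction along the given \<open>s\<close> sequence never revisits the new
  ones.\<close>

lemma star_postpone:
  assumes "r\<^sup>* O s \<subseteq> s\<^sup>* O r\<^sup>*"
  shows "r\<^sup>* O s\<^sup>* \<subseteq> s\<^sup>* O r\<^sup>*"
proof -
  have "(x, y) \<in> r\<^sup>* \<Longrightarrow> (x, z) \<in> s\<^sup>* O r\<^sup>*" if "(y, z) \<in> s\<^sup>*" for x y z
    using that
  proof (induction rule: rtrancl_induct)
    case base
    then show ?case by blast
  next
    case (step z z')
    then obtain u where u: "(x, u) \<in> s\<^sup>*" "(u, z) \<in> r\<^sup>*" by blast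
    with step.hyps(2) assms obtain v where "(u, v) \<in> s\<^sup>*" "(v, z') \<in> r\<^sup>*" by blast
    with u(1) show ?case by (meson relcompI rtrancl_trans)
  qed
  then show ?thesis by blast
qed

text \<open>Here \<open>f\<close> stands for the external steps of the other kind, so the lemma
  serves both \<alpha> and \<gamma>.\<close>

lemma internal_postpone:
  assumes fact: "e_factorizing e i" and swap: "i O f \<subseteq> f O (e \<union> i)\<^sup>*"
  shows "i\<^sup>* O (e \<union> f)\<^sup>* \<subseteq> (e \<union> f)\<^sup>* O i\<^sup>*"
proof (rule star_postpone)
  have ei: "(e \<union> i)\<^sup>* \<subseteq> (e \<union> f)\<^sup>* O i\<^sup>*"
    using fact rtrancl_mono[of e "e \<union> f"] unfolding e_factorizing_def by blast
  have "i\<^sup>* O e \<subseteq> (e \<union> i)\<^sup>*"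
  proof clarify
    fix x y z assume "(x, y) \<in> i\<^sup>*" "(y, z) \<in> e"
    moreover have "i\<^sup>* \<subseteq> (e \<union> i)\<^sup>*" by (simp add: rtrancl_mono)
    ultimately show "(x, z) \<in> (e \<union> i)\<^sup>*" by (meson UnI1 rtrancl.rtrancl_into_rtrancl subsetD)
  qed
  moreover have "i\<^sup>* O f \<subseteq> (e \<union> f)\<^sup>* O i\<^sup>*"
  proof -
    have "i\<^sup>* O f \<subseteq> f O (e \<union> i)\<^sup>*" using swap by (rule star_swap) simp
    \<comment> \<open>The swap leaves \<open>e\<close> and \<open>i\<close> steps interleaved after
      \<open>f\<close>; factorization sorts them.\<close>
    also have "\<dots> \<subseteq> f O (e \<union> f)\<^sup>* O i\<^sup>*" using ei by blast
    also have "\<dots> \<subseteq> (e \<union> f)\<^sup>* O i\<^sup>*"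
      by (blast intro: converse_rtrancl_into_rtrancl)
    finally show ?thesis .
  qed
  ultimately show "i\<^sup>* O (e \<union> f) \<subseteq> (e \<union> f)\<^sup>* O i\<^sup>*" using ei by blast
qed

text \<open>Prepend steps one at a time to an already factorized sequence: an \<open>e\<close> step
  joins its external prefix, an \<open>i\<close> step has to cross that prefix.\<close>

lemma e_factorizing_if_postpone:
  assumes "i O e\<^sup>* \<subseteq> e\<^sup>* O i\<^sup>*"
  shows "e_factorizing e i"
proof -
  have "(x, z) \<in> e\<^sup>* O i\<^sup>*" if "(x, z) \<in> (e \<union> i)\<^sup>*" for x z
    using that
  proof (induction rule: converse_rtrancl_induct)
    case base
    then show ?case by blast
  next
    case (step x y)
    then obtain u where u: "(y, u) \<in> e\<^sup>*" "(u, z) \<in> i\<^sup>*" by blast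
    from step.hyps(1) show ?case
    proof
      assume "(x, y) \<in> e"
      with u show ?thesis by (blast intro: converse_rtrancl_into_rtrancl)
    next
      assume "(x, y) \<in> i"
      with u(1) assms obtain v where "(x, v) \<in> e\<^sup>*" "(v, u) \<in> i\<^sup>*" by blast
      with u(2) show ?thesis by (meson relcompI rtrancl_trans)
    qed
  qed
  then show ?thesis unfolding e_factorizing_def by auto
qed

theorem theorem3p4:
  fixes e\<alpha> i\<alpha> e\<gamma> i\<gamma> :: "'a rel"
  assumes "e_factorizing e\<alpha> i\<alpha>"
    and "e_factorizing e\<gamma> i\<gamma>"
    and "i\<alpha> O e\<gamma> \<subseteq> e\<gamma> O (e\<alpha> \<union> i\<alpha>)\<^sup>*"
    and "i\<gamma> O e\<alpha> \<subseteq> e\<alpha> O (e\<gamma> \<union> i\<gamma>)\<^sup>*"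
  shows "e_factorizing (e\<alpha> \<union> e\<gamma>) (i\<alpha> \<union> i\<gamma>)"
proof (rule e_factorizing_if_postpone)
  let ?e = "e\<alpha> \<union> e\<gamma>" and ?i = "i\<alpha> \<union> i\<gamma>"
  have "i\<alpha>\<^sup>* O ?e\<^sup>* \<subseteq> ?e\<^sup>* O i\<alpha>\<^sup>*"
    using assms(1,3) by (rule internal_postpone)
  moreover have "i\<gamma>\<^sup>* O ?e\<^sup>* \<subseteq> ?e\<^sup>* O i\<gamma>\<^sup>*"
    using internal_postpone[OF assms(2,4)] by (simp add: Un_commute)
  moreover have "i\<alpha>\<^sup>* \<subseteq> ?i\<^sup>*" "i\<gamma>\<^sup>* \<subseteq> ?i\<^sup>*"
    by (simp_all add: rtrancl_mono)
  \<comment> \<open>A single internal step has one of the two kinds, so mixed internal sequences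
    never have to be moved.\<close>
  ultimately show "?i O ?e\<^sup>* \<subseteq> ?e\<^sup>* O ?i\<^sup>*"
    by blast
qed

end
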